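(* Let $L$ be a link with $\mu$ components, with Alexander module $M_A(L)$ over $\Lambda_\mu$, and let $\phi_L:M_A(L)\to I_\mu$ be the map appearing in the link module sequence of $L$. Then the operation on $M_A(L)$ defined by \[x\triangleright y=(\phi_L(y)+1)x-\phi_L(x)y\] satisfies the quandle axioms (Q1) $x\triangleright x=x$ and (Q3) $(x\triangleright y)\triangleright z=(x\triangleright z)\triangleright(y\triangleright z)$ for all $x,y,z\in M_A(L)$.
   Context: A link $L=K_1\cup\dots\cup K_\mu$ is a union of finitely many pairwise disjoint, tame (piecewise smooth), oriented embedded circles in $\mathbb{S}^3$, with indexed components. A diagram $D$ of $L$ is obtained from a regular projection to the plane (finitely many singularities, all transverse double points called crossings) by removing short segments of the underpassing arc at each crossing. $C(D)$ is the set of crossings; $A(D)$ is the set of connected components of $D$, called arcs; $\kappa:A(D)\to\{1,\dots,\mu\}$ is such that the arc $a$ is part of the image of $K_{\kappa(a)}$. At a crossing $c$, let $a_1$ be the overpassing arc, $a_2$ the underpassing arc on the right side of $a_1$ and $a_3$ the underpassing arc on the left side of $a_1$ (with respect to the orientation of $a_1$); so $\kappa(a_2)=\kappa(a_3)$. Let $\Lambda_\mu=\mathbb{Z}[t_1^{\pm1},\dots,t_\mu^{\pm1}]$. Let $\rho_D:\Lambda_\mu^{C(D)}\to\Lambda_\mu^{A(D)}$ be the $\Lambda_\mu$-linear map between free modules with $\rho_D(c)=(1-t_{\kappa(a_2)})a_1+t_{\kappa(a_1)}a_2-a_3$ at each crossing $c$. The Alexander module $M_A(L)$ is the cokernel of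 $\rho_D$, with quotient map $\gamma_D:\Lambda_\mu^{A(D)}\to M_A(L)$; up to isomorphism it does not depend on $D$. Let $I_\mu$ be the ideal of $\Lambda_\mu$ generated by $t_1-1,\dots,t_\mu-1$, and let $\phi_L:M_A(L)\to I_\mu$ be the $\Lambda_\mu$-linear epimorphism with $\phi_L(\gamma_D(a))=t_{\kappa(a)}-1$ for all $a\in A(D)$. The link module sequence of $L$ is $0\to\ker\phi_L\to M_A(L)\xrightarrow{\phi_L}I_\mu\to0$. *)

theory Defs
  imports
    "HOL-Analysis.Analysis"
    "HOL-Library.Poly_Mapping"
    "HOL-Algebra.Module"
    "HOL-Algebra.Ideal"
    "HOL-Algebra.AbelCoset"
begin

section \<open>Tame oriented links in the 3-sphere\<close>

definition smooth_regular_on :: "(real \<Rightarrow> 'a::real_normed_vector) \<Rightarrow> real \<Rightarrow> real \<Rightarrow> bool" where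
  "smooth_regular_on f a b \<longleftrightarrow>
     (\<exists>F :: nat \<Rightarrow> real \<Rightarrow> 'a.
        (\<forall>t\<in>{a..b}. F 0 t = f t) \<and>
        (\<forall>n. \<forall>t\<in>{a..b}. (F n has_vector_derivative F (Suc n) t) (at t within {a..b})) \<and>
        (\<forall>t\<in>{a..b}. F 1 t \<noteq> 0))"

definition piecewise_smooth :: "(real \<Rightarrow> 'a::real_normed_vector) \<Rightarrow> bool" where
  "piecewise_smooth f \<longleftrightarrow>
     (\<exists>S. finite S \<and>
        (\<forall>a b. 0 \<le> a \<and> a < b \<and> b \<le> 1 \<and> {a<..<b} \<inter> S = {} \<longrightarrow> smooth_regular_on f a b))"

text \<open>
  The components are indexed by the finite type \<^typ>\<open>'m\<close>, so the number of components is
  \<open>CARD('m)\<close>.  The \<open>i\<close>-th oriented circle is the image of a 1-periodic curve \<open>K i\<close>, oriented by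
  the direction of increasing parameter.
\<close>
definition is_link :: "('m::finite \<Rightarrow> real \<Rightarrow> real^4) \<Rightarrow> bool" where
  "is_link K \<longleftrightarrow>
     (\<forall>i. piecewise_smooth (K i)) \<and>
     (\<forall>i t. K i t \<in> sphere 0 1) \<and>
     (\<forall>i t. K i (t + 1) = K i t) \<and>
     (\<forall>i j s t. K i s = K j t \<longrightarrow> i = j \<and> s - t \<in> \<int>)"

section \<open>Link diagrams\<close>

text \<open>
  A projection of the link to the plane is given by a rotation \<open>rot\<close> of the 3-sphere followed by
  stereographic projection from the pole \<open>(0,0,0,1)\<close> to 3-space and by forgetting the third
  coordinate, which is the height.  Varying \<open>rot\<close> varies both the point at infinity and the
  direction of projection.  At a crossing \<open>c\<close> with underpassing parameter \<open>t\<close> the segment removed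
  is the image of the parameter interval \<open>(t - gap_pre c, t + gap_post c)\<close>.
\<close>
record 'm link_diagram =
  curve :: "'m \<Rightarrow> real \<Rightarrow> real^4"
  rot :: "real^4^4"
  gap_pre :: "real^2 \<Rightarrow> real"
  gap_post :: "real^2 \<Rightarrow> real"

definition plane_projection :: "real^4^4 \<Rightarrow> real^4 \<Rightarrow> real^2" where
  "plane_projection Q x =
     (let y = Q *v x in vector [y $ 1 / (1 - y $ 4), y $ 2 / (1 - y $ 4)])"

definition projection_height :: "real^4^4 \<Rightarrow> real^4 \<Rightarrow> real" where
  "projection_height Q x = (let y = Q *v x in y $ 3 / (1 - y $ 4))"

definition plane_curve :: "'m link_diagram \<Rightarrow> 'm \<Rightarrow> real \<Rightarrow> real^2" where
  "plane_curve D i t = plane_projection (rot D) (curve D i t)"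

definition height :: "'m link_diagram \<Rightarrow> 'm \<Rightarrow> real \<Rightarrow> real" where
  "height D i t = projection_height (rot D) (curve D i t)"

definition crossings :: "'m link_diagram \<Rightarrow> (real^2) set" where
  "crossings D =
     {c. \<exists>i s j t. curve D i s \<noteq> curve D j t \<and> plane_curve D i s = c \<and> plane_curve D j t = c}"

text \<open>Positive iff \<open>w\<close> points to the left of \<open>v\<close>.\<close>
definition plane_det :: "real^2 \<Rightarrow> real^2 \<Rightarrow> real" where
  "plane_det v w = v $ 1 * w $ 2 - v $ 2 * w $ 1"

text \<open>
  The singular points of the projected curve are the double points and the points where the
  projected (one-sided) velocity vanishes; the latter are not allowed.
\<close>
definition regular_projection :: "'m::finite link_diagram \<Rightarrow> bool" where
  "regular_projection D \<longleftrightarrow>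
     rotation_matrix (rot D) \<and>
     (\<forall>i t. (rot D *v curve D i t) $ 4 \<noteq> 1) \<and>
     finite (crossings D) \<and>
     (\<forall>c\<in>crossings D.
        card {x \<in> (\<Union>i. range (curve D i)). plane_projection (rot D) x = c} = 2) \<and>
     (\<forall>i s j t. curve D i s \<noteq> curve D j t \<and> plane_curve D i s = plane_curve D j t \<longrightarrow>
        (\<exists>v w. (plane_curve D i has_vector_derivative v) (at s) \<and>
               (plane_curve D j has_vector_derivative w) (at t) \<and> plane_det v w \<noteq> 0)) \<and>
     (\<forall>i t. (\<exists>v. v \<noteq> 0 \<and> (plane_curve D i has_vector_derivative v) (at_left t)) \<and>
            (\<exists>v. v \<noteq> 0 \<and> (plane_curve D i has_vector_derivative v) (at_right t)))"

text \<open>At \<open>c\<close>, the curve \<open>i\<close> at parameter \<open>s\<close> passes over the curve \<open>j\<close> at parameter \<open>t\<close>.\<close>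
definition crossing_at ::
    "'m link_diagram \<Rightarrow> real^2 \<Rightarrow> 'm \<Rightarrow> real \<Rightarrow> 'm \<Rightarrow> real \<Rightarrow> bool" where
  "crossing_at D c i s j t \<longleftrightarrow>
     plane_curve D i s = c \<and> plane_curve D j t = c \<and> height D j t < height D i s"

text \<open>
  Shortness of the removed segments: the closed parameter intervals contain no crossing parameter
  but their own, and distinct ones (including translates by periods) are disjoint.
\<close>
definition short_gaps :: "'m link_diagram \<Rightarrow> bool" where
  "short_gaps D \<longleftrightarrow>
     (\<forall>c\<in>crossings D. 0 < gap_pre D c \<and> 0 < gap_post D c) \<and>
     (\<forall>c i s j t u. crossing_at D c i s j t \<and> u \<in> {t - gap_pre D c..t + gap_post D c} \<and>
        plane_curve D j u \<in> crossings D \<longrightarrow> u = t) \<and>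
     (\<forall>c i s c' i' s' j t t'. crossing_at D c i s j t \<and> crossing_at D c' i' s' j t' \<and> t \<noteq> t' \<longrightarrow>
        {t - gap_pre D c..t + gap_post D c} \<inter> {t' - gap_pre D c'..t' + gap_post D c'} = {})"

definition is_diagram_of :: "'m::finite link_diagram \<Rightarrow> ('m \<Rightarrow> real \<Rightarrow> real^4) \<Rightarrow> bool" where
  "is_diagram_of D K \<longleftrightarrow> curve D = K \<and> regular_projection D \<and> short_gaps D"

definition removed_params :: "'m link_diagram \<Rightarrow> 'm \<Rightarrow> real set" where
  "removed_params D j =
     {u. \<exists>c i s t. crossing_at D c i s j t \<and> t - gap_pre D c < u \<and> u < t + gap_post D c}"

definition diagram_set :: "'m link_diagram \<Rightarrow> (real^2) set" where
  "diagram_set D = (\<Union>j. plane_curve D j ` (- removed_params D j))"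

definition arcs :: "'m link_diagram \<Rightarrow> (real^2) set set" where
  "arcs D = components (diagram_set D)"

definition arc_through :: "'m link_diagram \<Rightarrow> real^2 \<Rightarrow> (real^2) set" where
  "arc_through D p = connected_component_set (diagram_set D) p"

definition kappa :: "'m link_diagram \<Rightarrow> (real^2) set \<Rightarrow> 'm" where
  "kappa D a = (THE i. a \<subseteq> range (plane_curve D i))"

text \<open>The crossing point itself stays in the diagram, as a point of the overpassing strand.\<close>
definition over_arc :: "'m link_diagram \<Rightarrow> real^2 \<Rightarrow> (real^2) set" where
  "over_arc D c = arc_through D c"

text \<open>
  If the underpassing velocity points to the left of the overpassing one, then the underpassing
  strand arrives from the right and leaves to the left; otherwise it is the other way round.
\<close>
definition under_to_left :: "'m link_diagram \<Rightarrow> 'm \<Rightarrow> real \<Rightarrow> 'm \<Rightarrow> real \<Rightarrow> bool" where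
  "under_to_left D i s j t \<longleftrightarrow>
     0 < plane_det (vector_derivative (plane_curve D i) (at s))
                   (vector_derivative (plane_curve D j) (at t))"

definition right_under_arc :: "'m link_diagram \<Rightarrow> real^2 \<Rightarrow> (real^2) set" where
  "right_under_arc D c =
     (THE a. \<exists>i s j t. crossing_at D c i s j t \<and>
        a = arc_through D (plane_curve D j
              (if under_to_left D i s j t then t - gap_pre D c else t + gap_post D c)))"

definition left_under_arc :: "'m link_diagram \<Rightarrow> real^2 \<Rightarrow> (real^2) set" where
  "left_under_arc D c =
     (THE a. \<exists>i s j t. crossing_at D c i s j t \<and>
        a = arc_through D (plane_curve D j
              (if under_to_left D i s j t then t + gap_post D c else t - gap_pre D c)))"

section \<open>Laurent polynomials, free modules and quotient modules\<close>

text \<open>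
  The Laurent polynomial ring with integer coefficients in variables indexed by \<^typ>\<open>'m\<close>, as the
  group ring of the free abelian group of exponent vectors.
\<close>
type_synonym 'm laurent = "(int^'m) \<Rightarrow>\<^sub>0 int"

definition laurent_var :: "'m::finite \<Rightarrow> 'm laurent" where
  "laurent_var i = Poly_Mapping.single (axis i 1) 1"

definition laurent_ring :: "'m::finite laurent ring" where
  "laurent_ring = \<lparr>carrier = UNIV, mult = (*), one = 1, zero = 0, add = (+)\<rparr>"

definition augmentation_ideal :: "'m::finite laurent set" where
  "augmentation_ideal = Idl\<^bsub>laurent_ring\<^esub> (range (\<lambda>i. laurent_var i - 1))"

text \<open>
  The fields \<open>mult\<close> and \<open>one\<close> of a module record carry no information.
\<close>
definition augmentation_module :: "('m::finite laurent, 'm laurent) module" where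
  "augmentation_module =
     \<lparr>carrier = augmentation_ideal, mult = undefined, one = undefined,
      zero = 0, add = (+), smult = (*)\<rparr>"

definition free_module :: "'b set \<Rightarrow> ('m::finite laurent, 'b \<Rightarrow> 'm laurent) module" where
  "free_module B =
     \<lparr>carrier = {f. finite {b. f b \<noteq> 0} \<and> {b. f b \<noteq> 0} \<subseteq> B},
      mult = undefined, one = undefined,
      zero = (\<lambda>_. 0), add = (\<lambda>f g b. f b + g b), smult = (\<lambda>r f b. r * f b)\<rparr>"

definition basis_vec :: "'b \<Rightarrow> 'b \<Rightarrow> 'm::finite laurent" where
  "basis_vec b = (\<lambda>b'. if b' = b then 1 else 0)"

definition quotient_module :: "('r, 'x) module \<Rightarrow> 'x set \<Rightarrow> ('r, 'x set) module" where
  "quotient_module M N =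
     \<lparr>carrier = a_rcosets\<^bsub>M\<^esub> N, mult = undefined, one = undefined,
      zero = N, add = set_add M,
      smult = (\<lambda>r X. \<Union>x\<in>X. N +>\<^bsub>M\<^esub> (r \<odot>\<^bsub>M\<^esub> x))\<rparr>"

definition linear_maps ::
    "('r, 's) ring_scheme \<Rightarrow> ('r, 'x) module \<Rightarrow> ('r, 'y) module \<Rightarrow> ('x \<Rightarrow> 'y) set" where
  "linear_maps R M N =
     {f \<in> carrier M \<rightarrow> carrier N.
        (\<forall>x\<in>carrier M. \<forall>y\<in>carrier M. f (x \<oplus>\<^bsub>M\<^esub> y) = f x \<oplus>\<^bsub>N\<^esub> f y) \<and>
        (\<forall>r\<in>carrier R. \<forall>x\<in>carrier M. f (r \<odot>\<^bsub>M\<^esub> x) = r \<odot>\<^bsub>N\<^esub> f x)}"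

section \<open>The Alexander module and the link module sequence\<close>

definition crossing_relator ::
    "'m::finite link_diagram \<Rightarrow> real^2 \<Rightarrow> (real^2) set \<Rightarrow> 'm laurent" where
  "crossing_relator D c =
     (let a1 = over_arc D c; a2 = right_under_arc D c; a3 = left_under_arc D c in
      (\<lambda>a. (1 - laurent_var (kappa D a2)) * basis_vec a1 a
           + laurent_var (kappa D a1) * basis_vec a2 a - basis_vec a3 a))"

definition rho :: "'m::finite link_diagram \<Rightarrow> (real^2 \<Rightarrow> 'm laurent) \<Rightarrow> (real^2) set \<Rightarrow> 'm laurent" where
  "rho D f = (\<lambda>a. \<Sum>c\<in>crossings D. f c * crossing_relator D c a)"

definition alexander_module ::
    "'m::finite link_diagram \<Rightarrow> ('m laurent, ((real^2) set \<Rightarrow> 'm laurent) set) module" where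
  "alexander_module D =
     quotient_module (free_module (arcs D)) (rho D ` carrier (free_module (crossings D)))"

definition gamma ::
    "'m::finite link_diagram \<Rightarrow> ((real^2) set \<Rightarrow> 'm laurent) \<Rightarrow> ((real^2) set \<Rightarrow> 'm laurent) set" where
  "gamma D f =
     (rho D ` carrier (free_module (crossings D))) +>\<^bsub>free_module (arcs D)\<^esub> f"

definition is_link_module_map ::
    "'m::finite link_diagram \<Rightarrow> (((real^2) set \<Rightarrow> 'm laurent) set \<Rightarrow> 'm laurent) \<Rightarrow> bool" where
  "is_link_module_map D \<phi> \<longleftrightarrow>
     \<phi> \<in> linear_maps laurent_ring (alexander_module D) augmentation_module \<and>
     \<phi> ` carrier (alexander_module D) = augmentation_ideal \<and>
     (\<forall>a\<in>arcs D. \<phi> (gamma D (basis_vec a)) = laurent_var (kappa D a) - 1)"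

definition quandle_op ::
    "('r, 's) ring_scheme \<Rightarrow> ('r, 'x) module \<Rightarrow> ('x \<Rightarrow> 'r) \<Rightarrow> 'x \<Rightarrow> 'x \<Rightarrow> 'x" where
  "quandle_op R M \<phi> x y =
     ((\<phi> y \<oplus>\<^bsub>R\<^esub> \<one>\<^bsub>R\<^esub>) \<odot>\<^bsub>M\<^esub> x) \<ominus>\<^bsub>M\<^esub> (\<phi> x \<odot>\<^bsub>M\<^esub> y)"

section \<open>Existence of the Alexander module and of the map to the augmentation ideal\<close>

lemma diff_Ints_periodic:
  assumes p: "\<And>t. f (t + 1) = f (t::real)" and "s - t \<in> \<int>"
  shows "f s = f t"
proof -
  have n: "f (t + real n) = f t" for n t
  proof (induction n arbitrary: t)
    case (Suc n)
    have "f (t + real (Suc n)) = f ((t + real n) + 1)" by (simp add: algebra_simps)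
    then show ?case using p Suc by simp
  qed simp
  from assms(2) obtain k :: int where k: "s - t = of_int k" by (auto elim: Ints_cases)
  show ?thesis
  proof (cases "k \<ge> 0")
    case True
    then have "s = t + real (nat k)" using k by simp
    then show ?thesis using n by metis
  next
    case False
    then have "t = s + real (nat (-k))" using k by simp
    then show ?thesis using n by metis
  qed
qed

lemma vector_derivative_periodic:
  fixes f :: "real \<Rightarrow> 'a::real_normed_vector"
  assumes p: "\<And>t. f (t + 1) = f t" and k: "s - t \<in> \<int>"
  shows "vector_derivative f (at s) = vector_derivative f (at t)"
proof -
  have *: "(f has_vector_derivative v) (at t)"
    if "(f has_vector_derivative v) (at s)" "s - t \<in> \<int>" for v s t
  proof -
    have "((\<lambda>x. x + (s - t)) has_vector_derivative 1) (at t)"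
      by (auto intro!: derivative_eq_intros)
    moreover have "(f has_vector_derivative v) (at ((\<lambda>x. x + (s - t)) t))"
      using that by simp
    ultimately have "(f \<circ> (\<lambda>x. x + (s - t)) has_vector_derivative (1 *\<^sub>R v)) (at t)"
      by (rule vector_diff_chain_at)
    moreover have "f \<circ> (\<lambda>x. x + (s - t)) = f"
      using diff_Ints_periodic[of f, OF p] that(2) by (auto simp: fun_eq_iff)
    ultimately show ?thesis by simp
  qed
  have k': "t - s \<in> \<int>" using k by (metis Ints_minus minus_diff_eq)
  have "(f has_vector_derivative v) (at s) \<longleftrightarrow> (f has_vector_derivative v) (at t)" for v
    using * k k' by blast
  then show ?thesis by (simp add: vector_derivative_def)
qed

lemma stereographic_inj:
  fixes a b :: "real^4"
  assumes "norm a = 1" "norm b = 1" "a $ 4 \<noteq> 1" "b $ 4 \<noteq> 1"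
    and e: "\<And>i. i \<in> {1,2,3} \<Longrightarrow> a $ i / (1 - a $ 4) = b $ i / (1 - b $ 4)"
  shows "a = b"
proof -
  define z1 z2 z3 where z: "z1 = a $ 1 / (1 - a $ 4)" "z2 = a $ 2 / (1 - a $ 4)" "z3 = a $ 3 / (1 - a $ 4)"
  have zb: "z1 = b $ 1 / (1 - b $ 4)" "z2 = b $ 2 / (1 - b $ 4)" "z3 = b $ 3 / (1 - b $ 4)"
    using e z by auto
  have A: "a $ 1 = z1 * (1 - a $ 4)" "a $ 2 = z2 * (1 - a $ 4)" "a $ 3 = z3 * (1 - a $ 4)"
    using z assms(3) by simp_all
  have B: "b $ 1 = z1 * (1 - b $ 4)" "b $ 2 = z2 * (1 - b $ 4)" "b $ 3 = z3 * (1 - b $ 4)"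
    using zb assms(4) by simp_all
  define Z where "Z = z1^2 + z2^2 + z3^2"
  have key: "y $ 4 = (Z - 1) / (Z + 1)"
    if "norm y = 1" "y $ 4 \<noteq> 1" and Y: "y $ 1 = z1 * (1 - y $ 4)" "y $ 2 = z2 * (1 - y $ 4)" "y $ 3 = z3 * (1 - y $ 4)"
    for y :: "real^4"
  proof -
    have "y \<bullet> y = 1" using that(1) by (simp add: norm_eq_1)
    then have "y$1 * y$1 + y$2 * y$2 + y$3 * y$3 + y$4 * y$4 = 1"
      by (simp add: inner_vec_def sum_4)
    then have "(1 - y$4) * (Z * (1 - y$4) - (1 + y$4)) = 0"
      unfolding Y Z_def by (simp add: algebra_simps power2_eq_square)
    then have "Z * (1 - y$4) = 1 + y$4" using that(2) by simp
    moreover have "Z + 1 > 0" unfolding Z_def by (simp add: add_nonneg_pos)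
    ultimately show ?thesis by (simp add: field_simps)
  qed
  have "a $ 4 = b $ 4" using key[of a] key[of b] A B assms by simp
  then show ?thesis using A B by (simp add: vec_eq_iff forall_4)
qed

context
  fixes D :: "'m::finite link_diagram"
  assumes link: "is_link (curve D)" and dia: "is_diagram_of D (curve D)"
begin

private lemma reg: "regular_projection D" and short: "short_gaps D"
  using dia by (auto simp: is_diagram_of_def)

private lemma curve_period: "curve D i (t + 1) = curve D i t"
  using link by (simp add: is_link_def)

private lemma plane_period: "plane_curve D i (t + 1) = plane_curve D i t"
  by (simp add: plane_curve_def curve_period)

private lemma height_period: "height D i (t + 1) = height D i t"
  by (simp add: height_def curve_period)

private lemma plane_shift: "s - t \<in> \<int> \<Longrightarrow> plane_curve D i s = plane_curve D i t"
  by (rule diff_Ints_periodic[of "plane_curve D i"]) (auto simp: plane_period)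

private lemma height_shift: "s - t \<in> \<int> \<Longrightarrow> height D i s = height D i t"
  by (rule diff_Ints_periodic[of "height D i"]) (auto simp: height_period)

private lemma curve_eqD: "curve D i s = curve D j t \<Longrightarrow> i = j \<and> s - t \<in> \<int>"
  using link by (simp add: is_link_def)

private lemma height_neq:
  assumes "curve D i s \<noteq> curve D j t" "plane_curve D i s = plane_curve D j t"
  shows "height D i s \<noteq> height D j t"
proof
  assume h: "height D i s = height D j t"
  define a where "a = rot D *v curve D i s"
  define b where "b = rot D *v curve D j t"
  have o: "orthogonal_matrix (rot D)"
    using reg by (simp add: regular_projection_def rotation_matrix_def)
  then have ot: "orthogonal_transformation ((*v) (rot D))"
    by (simp add: orthogonal_transformation_matrix)
  have "norm a = 1" "norm b = 1"
    using link ot by (simp_all add: a_def b_def orthogonal_transformation_norm is_link_def)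
  moreover have "a $ 4 \<noteq> 1" "b $ 4 \<noteq> 1"
    using reg by (simp_all add: a_def b_def regular_projection_def)
  moreover have "a $ i / (1 - a $ 4) = b $ i / (1 - b $ 4)" if "i \<in> {1,2,3}" for i
    using that assms(2) h
    by (auto simp: plane_curve_def plane_projection_def height_def projection_height_def
        Let_def a_def b_def vec_eq_iff forall_2)
  ultimately have "a = b" using stereographic_inj by blast
  then have "curve D i s = curve D j t"
    using ot orthogonal_transformation_inj unfolding a_def b_def by (metis injD)
  then show False using assms by simp
qed

private lemma crossing_at_crossings:
  "crossing_at D c i s j t \<Longrightarrow> c \<in> crossings D"
  unfolding crossing_at_def crossings_def height_def
  by (metis (mono_tags, lifting) mem_Collect_eq order_less_irrefl)

private lemma crossing_at_ex:
  assumes "curve D i s \<noteq> curve D j t" "plane_curve D i s = plane_curve D j t"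
  shows "crossing_at D (plane_curve D i s) i s j t \<or> crossing_at D (plane_curve D i s) j t i s"
  using height_neq[OF assms] assms by (auto simp: crossing_at_def)

private lemma crossing_obtain:
  assumes "c \<in> crossings D"
  obtains i s j t where "crossing_at D c i s j t"
proof -
  obtain i s j t where "curve D i s \<noteq> curve D j t" "plane_curve D i s = c" "plane_curve D j t = c"
    using assms unfolding crossings_def by blast
  then show ?thesis using crossing_at_ex[of i s j t] that by auto
qed

private lemma crossing_at_unique:
  assumes "crossing_at D c i s j t" "crossing_at D c i' s' j' t'"
  shows "i = i' \<and> j = j' \<and> s - s' \<in> \<int> \<and> t - t' \<in> \<int>"
proof -
  let ?X = "{x \<in> (\<Union>i. range (curve D i)). plane_projection (rot D) x = c}"
  have "card ?X = 2"
    using reg crossing_at_crossings[OF assms(1)] by (simp add: regular_projection_def)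
  then obtain p q where X: "?X = {p, q}" by (auto simp: card_2_iff)
  have "curve D i s \<in> ?X" "curve D j t \<in> ?X" "curve D i' s' \<in> ?X" "curve D j' t' \<in> ?X"
    using assms by (auto simp: crossing_at_def plane_curve_def)
  moreover have "projection_height (rot D) (curve D j t) < projection_height (rot D) (curve D i s)"
    "projection_height (rot D) (curve D j' t') < projection_height (rot D) (curve D i' s')"
    using assms by (auto simp: crossing_at_def height_def)
  ultimately have "curve D i s = curve D i' s'" "curve D j t = curve D j' t'"
    unfolding X by (force)+
  then show ?thesis using curve_eqD by blast
qed

private lemma crossing_at_shift:
  assumes "crossing_at D c i s j t" "t' - t \<in> \<int>"
  shows "crossing_at D c i s j t'"
  using assms by (simp add: crossing_at_def plane_shift[OF assms(2)] height_shift[OF assms(2)])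

private lemma gap_pos: "c \<in> crossings D \<Longrightarrow> 0 < gap_pre D c" "c \<in> crossings D \<Longrightarrow> 0 < gap_post D c"
  using short by (auto simp: short_gaps_def)

private lemma gap_only:
  "crossing_at D c i s j t \<Longrightarrow> u \<in> {t - gap_pre D c..t + gap_post D c} \<Longrightarrow>
    plane_curve D j u \<in> crossings D \<Longrightarrow> u = t"
  using short unfolding short_gaps_def by blast

private lemma gap_disjoint:
  "crossing_at D c i s j t \<Longrightarrow> crossing_at D c' i' s' j t' \<Longrightarrow>
    u \<in> {t - gap_pre D c..t + gap_post D c} \<Longrightarrow> u \<in> {t' - gap_pre D c'..t' + gap_post D c'} \<Longrightarrow>
    t = t'"
  using short unfolding short_gaps_def by blast

private lemma gap_ends:
  assumes "crossing_at D c i s j t" "u = t - gap_pre D c \<or> u = t + gap_post D c"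
  shows "u \<notin> removed_params D j" "plane_curve D j u \<notin> crossings D"
proof -
  note g = gap_pos[OF crossing_at_crossings[OF assms(1)]]
  have u: "u \<in> {t - gap_pre D c..t + gap_post D c}" using assms(2) g by auto
  show "plane_curve D j u \<notin> crossings D"
    using gap_only[OF assms(1) u] assms(2) g by auto
  show "u \<notin> removed_params D j"
  proof
    assume "u \<in> removed_params D j"
    then obtain c' i' s' t' where c': "crossing_at D c' i' s' j t'"
      "t' - gap_pre D c' < u" "u < t' + gap_post D c'"
      unfolding removed_params_def by blast
    then have "t = t'" using gap_disjoint[OF assms(1) c'(1) u] by auto
    then have "c = c'" using assms(1) c'(1) by (simp add: crossing_at_def)
    then show False using \<open>t = t'\<close> c' assms(2) by auto
  qed
qed

private lemma under_removed:
  assumes "crossing_at D c i s j t" shows "t \<in> removed_params D j"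
  using assms gap_pos[OF crossing_at_crossings[OF assms]] unfolding removed_params_def by fastforce

private lemma over_not_removed:
  assumes "crossing_at D c i s j t" shows "s \<notin> removed_params D i"
proof
  assume "s \<in> removed_params D i"
  then obtain c' i' s' t' where c': "crossing_at D c' i' s' i t'"
    "t' - gap_pre D c' < s" "s < t' + gap_post D c'"
    unfolding removed_params_def by blast
  have "plane_curve D i s \<in> crossings D"
    using crossing_at_crossings[OF assms] assms by (simp add: crossing_at_def)
  then have "s = t'" using gap_only[OF c'(1)] c' by simp
  then have "c = c'" using assms c' by (simp add: crossing_at_def)
  then have "i = i' \<and> i = j \<and> s - s' \<in> \<int> \<and> t - t' \<in> \<int>"
    using crossing_at_unique[OF assms, of i' s' i t'] c' by auto
  then have "height D j t = height D i s" using height_shift[of t t' i] \<open>s = t'\<close> by metis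
  then show False using assms by (simp add: crossing_at_def)
qed

private lemma removed_shift:
  assumes "u \<in> removed_params D j" "v - u \<in> \<int>"
  shows "v \<in> removed_params D j"
proof -
  obtain c i s t where "crossing_at D c i s j t" "t - gap_pre D c < u" "u < t + gap_post D c"
    using assms(1) unfolding removed_params_def by blast
  then have "crossing_at D c i s j (t + (v - u))" "t + (v - u) - gap_pre D c < v"
    "v < t + (v - u) + gap_post D c"
    using crossing_at_shift[of c i s j t "t + (v - u)"] assms(2) by auto
  then show ?thesis unfolding removed_params_def by blast
qed

private lemma open_removed: "open (removed_params D j)"
proof -
  have "removed_params D j = (\<Union>(c,i,s,t)\<in>{(c,i,s,t). crossing_at D c i s j t}.
      {t - gap_pre D c<..<t + gap_post D c})"
    unfolding removed_params_def by force
  then show ?thesis by (simp add: open_UN case_prod_unfold)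
qed

private lemma cont_plane: "continuous_on S (plane_curve D j)"
proof -
  have "isCont (plane_curve D j) t" for t
  proof -
    obtain v w where "(plane_curve D j has_vector_derivative v) (at_left t)"
      "(plane_curve D j has_vector_derivative w) (at_right t)"
      using reg unfolding regular_projection_def by meson
    then show ?thesis
      using has_vector_derivative_continuous continuous_at_split by blast
  qed
  then show ?thesis by (simp add: continuous_at_imp_continuous_on)
qed

private definition strand :: "'m \<Rightarrow> (real^2) set" where
  "strand j = plane_curve D j ` (- removed_params D j)"

private lemma strand_range: "strand j \<subseteq> range (plane_curve D j)"
  by (auto simp: strand_def)

private lemma strand_compact: "compact (strand j)"
proof -
  have "strand j = plane_curve D j ` ({0..1} - removed_params D j)"
  proof
    show "strand j \<subseteq> plane_curve D j ` ({0..1} - removed_params D j)"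
    proof
      fix p assume "p \<in> strand j"
      then obtain u where u: "p = plane_curve D j u" "u \<notin> removed_params D j"
        by (auto simp: strand_def)
      have "frac u - u \<in> \<int>" by (simp add: frac_def)
      then have "u - frac u \<in> \<int>" by (metis Ints_minus minus_diff_eq)
      then have "frac u \<notin> removed_params D j" "p = plane_curve D j (frac u)"
        using removed_shift[of "frac u" j u] plane_shift u by auto
      moreover have "frac u \<in> {0..1}" using frac_lt_1[of u] by simp
      ultimately show "p \<in> plane_curve D j ` ({0..1} - removed_params D j)" by blast
    qed
  qed (auto simp: strand_def)
  moreover have "compact ({0..1} - removed_params D j)"
    by (intro compact_diff open_removed) auto
  ultimately show ?thesis using compact_continuous_image cont_plane by metis
qed

private lemma strand_disjoint:
  assumes "i \<noteq> j" shows "strand i \<inter> strand j = {}"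
proof (rule ccontr)
  assume "strand i \<inter> strand j \<noteq> {}"
  then obtain u v where uv: "u \<notin> removed_params D i" "v \<notin> removed_params D j"
    "plane_curve D i u = plane_curve D j v" by (auto simp: strand_def)
  then have "curve D i u \<noteq> curve D j v" using curve_eqD assms by blast
  from crossing_at_ex[OF this uv(3)] show False using uv under_removed by blast
qed

private lemma diagram_strands: "diagram_set D = (\<Union>j. strand j)"
  by (simp add: diagram_set_def strand_def)

private lemma arc_in_strand:
  assumes "p \<in> strand j" shows "arc_through D p \<subseteq> strand j" "p \<in> arc_through D p"
    "arc_through D p \<in> arcs D"
proof -
  have p: "p \<in> diagram_set D" using assms diagram_strands by auto
  show pa: "p \<in> arc_through D p" using p by (simp add: arc_through_def connected_component_refl)
  show "arc_through D p \<in> arcs D"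
    using p by (auto simp: arcs_def arc_through_def components_def)
  let ?E = "\<Union>i\<in>-{j}. strand i"
  have "closed (strand j)" "closed ?E"
    by (auto intro!: compact_imp_closed strand_compact closed_UN)
  moreover have "connected (arc_through D p)" by (simp add: arc_through_def)
  moreover have sub: "arc_through D p \<subseteq> strand j \<union> ?E"
    using connected_component_subset[of "diagram_set D" p] diagram_strands
    unfolding arc_through_def by fastforce
  moreover have "strand j \<inter> ?E = {}" using strand_disjoint by blast
  ultimately have "strand j \<inter> arc_through D p = {} \<or> ?E \<inter> arc_through D p = {}"
    by (intro connected_closedD) auto
  then show "arc_through D p \<subseteq> strand j" using pa assms sub by blast
qed

private lemma kappa_arc:
  assumes "p \<in> strand j" "p \<notin> crossings D"
  shows "kappa D (arc_through D p) = j"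
  unfolding kappa_def
proof (rule the_equality)
  show "arc_through D p \<subseteq> range (plane_curve D j)"
    using arc_in_strand[OF assms(1)] strand_range by blast
  fix k assume "arc_through D p \<subseteq> range (plane_curve D k)"
  then obtain v where v: "p = plane_curve D k v" using arc_in_strand[OF assms(1)] by blast
  obtain u where u: "p = plane_curve D j u" using assms(1) by (auto simp: strand_def)
  have "curve D k v = curve D j u" using u v assms(2) unfolding crossings_def by force
  then show "k = j" using curve_eqD by blast
qed

lemma ex_arc_of_component: "\<exists>a\<in>arcs D. kappa D a = j"
proof -
  have "\<exists>p\<in>strand j. p \<notin> crossings D"
  proof (cases "removed_params D j = {}")
    case False
    then obtain c i s t where "crossing_at D c i s j t" by (auto simp: removed_params_def)
    from gap_ends[OF this] show ?thesis by (auto simp: strand_def)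
  next
    case True
    show ?thesis
    proof (rule ccontr)
      assume "\<not> ?thesis"
      then have "plane_curve D j ` {0..<1} \<subseteq> crossings D"
        using True by (auto simp: strand_def)
      then have "finite (plane_curve D j ` {0..<1})"
        using reg finite_subset unfolding regular_projection_def by blast
      moreover have "infinite {0..<1::real}" by simp
      ultimately obtain u where u: "u \<in> {0..<1}"
        "infinite {v \<in> {0..<1}. plane_curve D j v = plane_curve D j u}"
        using pigeonhole_infinite[of "{0..<1::real}" "plane_curve D j"] by metis
      let ?V = "{v \<in> {0..<1}. plane_curve D j v = plane_curve D j u}"
      define X where
        "X = {x \<in> (\<Union>i. range (curve D i)). plane_projection (rot D) x = plane_curve D j u}"
      have "plane_curve D j u \<in> crossings D" using u \<open>plane_curve D j ` {0..<1} \<subseteq> crossings D\<close> by blast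
      then have "card X = 2" using reg by (simp add: regular_projection_def X_def)
      then have "0 < card X" by simp
      then have "finite X" by (rule card_ge_0_finite)
      moreover have "curve D j ` ?V \<subseteq> X"
      proof
        fix x assume "x \<in> curve D j ` ?V"
        then show "x \<in> X" unfolding X_def plane_curve_def by blast
      qed
      ultimately have "finite (curve D j ` ?V)" using finite_subset by blast
      moreover have "inj_on (curve D j) ?V"
      proof (rule inj_onI)
        fix x y assume "x \<in> ?V" "y \<in> ?V" "curve D j x = curve D j y"
        then have "x - y \<in> \<int>" "\<bar>x - y\<bar> < 1" using curve_eqD[of j x j y] by auto
        then have "x - y = 0" using Ints_nonzero_abs_less1 by blast
        then show "x = y" by simp
      qed
      ultimately show False using u(2) finite_imageD by blast
    qed
  qed
  then show ?thesis using kappa_arc arc_in_strand by blast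
qed

private lemma under_arcs:
  assumes "crossing_at D c i s j t"
  shows "right_under_arc D c = arc_through D (plane_curve D j
              (if under_to_left D i s j t then t - gap_pre D c else t + gap_post D c))"
    and "left_under_arc D c = arc_through D (plane_curve D j
              (if under_to_left D i s j t then t + gap_post D c else t - gap_pre D c))"
proof -
  have *: "i' = i \<and> j' = j \<and> under_to_left D i' s' j' t' = under_to_left D i s j t \<and>
      plane_curve D j' (t' - gap_pre D c) = plane_curve D j (t - gap_pre D c) \<and>
      plane_curve D j' (t' + gap_post D c) = plane_curve D j (t + gap_post D c)"
    if "crossing_at D c i' s' j' t'" for i' s' j' t'
  proof -
    have u: "i' = i" "j' = j" "s' - s \<in> \<int>" "t' - t \<in> \<int>"
      using crossing_at_unique[OF that assms] by auto
    then show ?thesis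
      using vector_derivative_periodic[of "plane_curve D i" s' s]
        vector_derivative_periodic[of "plane_curve D j" t' t]
      by (simp add: under_to_left_def plane_period
          plane_shift[of "t' - gap_pre D c" "t - gap_pre D c"]
          plane_shift[of "t' + gap_post D c" "t + gap_post D c"])
  qed
  show "right_under_arc D c = arc_through D (plane_curve D j
              (if under_to_left D i s j t then t - gap_pre D c else t + gap_post D c))"
    unfolding right_under_arc_def
    by (rule the_equality, use assms in blast) (metis *)
  show "left_under_arc D c = arc_through D (plane_curve D j
              (if under_to_left D i s j t then t + gap_post D c else t - gap_pre D c))"
    unfolding left_under_arc_def
    by (rule the_equality, use assms in blast) (metis *)
qed

lemma crossing_arcs:
  assumes "c \<in> crossings D"
  shows "over_arc D c \<in> arcs D" "right_under_arc D c \<in> arcs D" "left_under_arc D c \<in> arcs D"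
    and "kappa D (right_under_arc D c) = kappa D (left_under_arc D c)"
proof -
  obtain i s j t where c: "crossing_at D c i s j t" using crossing_obtain[OF assms] .
  have "c \<in> strand i" using over_not_removed[OF c] c by (auto simp: strand_def crossing_at_def)
  then show "over_arc D c \<in> arcs D" by (simp add: over_arc_def arc_in_strand)
  let ?p = "plane_curve D j (t - gap_pre D c)" and ?q = "plane_curve D j (t + gap_post D c)"
  have pq: "?p \<in> strand j" "?q \<in> strand j" "?p \<notin> crossings D" "?q \<notin> crossings D"
    using gap_ends[OF c] by (auto simp: strand_def)
  show "right_under_arc D c \<in> arcs D" "left_under_arc D c \<in> arcs D"
    and "kappa D (right_under_arc D c) = kappa D (left_under_arc D c)"
    unfolding under_arcs[OF c] using pq by (auto simp: arc_in_strand kappa_arc)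
qed

lemma finite_crossings: "finite (crossings D)"
  using reg by (simp add: regular_projection_def)

end

lemma quotient_module:
  assumes "Module.module R M" "submodule N R M"
  shows "Module.module R (quotient_module M N)"
    and "\<And>x y. x \<in> carrier M \<Longrightarrow> y \<in> carrier M \<Longrightarrow>
      (N +>\<^bsub>M\<^esub> x) \<oplus>\<^bsub>quotient_module M N\<^esub> (N +>\<^bsub>M\<^esub> y) = N +>\<^bsub>M\<^esub> (x \<oplus>\<^bsub>M\<^esub> y)"
    and "\<And>r x. r \<in> carrier R \<Longrightarrow> x \<in> carrier M \<Longrightarrow>
      r \<odot>\<^bsub>quotient_module M N\<^esub> (N +>\<^bsub>M\<^esub> x) = N +>\<^bsub>M\<^esub> (r \<odot>\<^bsub>M\<^esub> x)"
proof -
  interpret Module.module R M by fact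
  interpret N: submodule N R M by fact
  interpret N: abelian_subgroup N M
    by (rule abelian_subgroupI3[OF additive_subgroupI[OF N.subgroup_axioms] abelian_group_axioms])
  let ?Q = "quotient_module M N"
  show add: "(N +>\<^bsub>M\<^esub> x) \<oplus>\<^bsub>?Q\<^esub> (N +>\<^bsub>M\<^esub> y) = N +>\<^bsub>M\<^esub> (x \<oplus>\<^bsub>M\<^esub> y)"
    if "x \<in> carrier M" "y \<in> carrier M" for x y
    using N.a_rcos_sum that by (simp add: quotient_module_def)
  show sm: "r \<odot>\<^bsub>?Q\<^esub> (N +>\<^bsub>M\<^esub> x) = N +>\<^bsub>M\<^esub> (r \<odot>\<^bsub>M\<^esub> x)"
    if r: "r \<in> carrier R" and x: "x \<in> carrier M" for r x
  proof -
    have "N +>\<^bsub>M\<^esub> (r \<odot>\<^bsub>M\<^esub> y) = N +>\<^bsub>M\<^esub> (r \<odot>\<^bsub>M\<^esub> x)" if "y \<in> N +>\<^bsub>M\<^esub> x" for y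
    proof -
      have "\<exists>n\<in>N. y = n \<oplus>\<^bsub>M\<^esub> x"
        using that unfolding a_r_coset_def' UN_iff singleton_iff .
      then obtain n where n: "n \<in> N" "y = n \<oplus>\<^bsub>M\<^esub> x" ..
      have "r \<odot>\<^bsub>M\<^esub> y = r \<odot>\<^bsub>M\<^esub> n \<oplus>\<^bsub>M\<^esub> r \<odot>\<^bsub>M\<^esub> x"
        unfolding n(2) by (rule smult_r_distr[OF r N.a_Hcarr[OF n(1)] x])
      then have "r \<odot>\<^bsub>M\<^esub> y \<in> N +>\<^bsub>M\<^esub> (r \<odot>\<^bsub>M\<^esub> x)"
        using N.smult_closed[OF r n(1)] unfolding a_r_coset_def' by blast
      then show ?thesis
        using N.a_repr_independence' smult_closed[OF r x] by metis
    qed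
    moreover have "x \<in> N +>\<^bsub>M\<^esub> x" using N.a_rcos_self x by simp
    ultimately have "(\<Union>y\<in>N +>\<^bsub>M\<^esub> x. N +>\<^bsub>M\<^esub> (r \<odot>\<^bsub>M\<^esub> y)) = N +>\<^bsub>M\<^esub> (r \<odot>\<^bsub>M\<^esub> x)"
      by blast
    then show ?thesis by (simp add: quotient_module_def)
  qed
  have car: "carrier ?Q = {N +>\<^bsub>M\<^esub> x |x. x \<in> carrier M}"
    by (auto simp: quotient_module_def A_RCOSETS_def')
  have zero: "\<zero>\<^bsub>?Q\<^esub> = N +>\<^bsub>M\<^esub> \<zero>\<^bsub>M\<^esub>"
    using a_coset_add_zero[OF N.a_subset] by (simp add: quotient_module_def)
  have ag: "abelian_group ?Q"
  proof (rule abelian_groupI)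
    show "X \<oplus>\<^bsub>?Q\<^esub> Y \<in> carrier ?Q" if "X \<in> carrier ?Q" "Y \<in> carrier ?Q" for X Y
      using that add a_closed unfolding car by blast
    show "\<zero>\<^bsub>?Q\<^esub> \<in> carrier ?Q" unfolding zero car by blast
    show "X \<oplus>\<^bsub>?Q\<^esub> Y \<oplus>\<^bsub>?Q\<^esub> Z = X \<oplus>\<^bsub>?Q\<^esub> (Y \<oplus>\<^bsub>?Q\<^esub> Z)"
      if XYZ: "X \<in> carrier ?Q" "Y \<in> carrier ?Q" "Z \<in> carrier ?Q" for X Y Z
    proof -
      obtain x y z where "X = N +>\<^bsub>M\<^esub> x" "Y = N +>\<^bsub>M\<^esub> y" "Z = N +>\<^bsub>M\<^esub> z"
        "x \<in> carrier M" "y \<in> carrier M" "z \<in> carrier M" using XYZ unfolding car by blast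
      then show ?thesis by (simp add: add a_assoc)
    qed
    show "X \<oplus>\<^bsub>?Q\<^esub> Y = Y \<oplus>\<^bsub>?Q\<^esub> X" if XY: "X \<in> carrier ?Q" "Y \<in> carrier ?Q" for X Y
    proof -
      obtain x y where "X = N +>\<^bsub>M\<^esub> x" "Y = N +>\<^bsub>M\<^esub> y" "x \<in> carrier M" "y \<in> carrier M"
        using XY unfolding car by blast
      then show ?thesis by (simp add: add a_comm)
    qed
    fix X assume "X \<in> carrier ?Q"
    then obtain x where x: "X = N +>\<^bsub>M\<^esub> x" "x \<in> carrier M" unfolding car by blast
    show "\<zero>\<^bsub>?Q\<^esub> \<oplus>\<^bsub>?Q\<^esub> X = X" using x by (simp add: zero add)
    have "(N +>\<^bsub>M\<^esub> \<ominus>\<^bsub>M\<^esub> x) \<oplus>\<^bsub>?Q\<^esub> X = \<zero>\<^bsub>?Q\<^esub>" using x by (simp add: zero add M.l_neg)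
    moreover have "N +>\<^bsub>M\<^esub> \<ominus>\<^bsub>M\<^esub> x \<in> carrier ?Q" using x(2) a_inv_closed unfolding car by blast
    ultimately show "\<exists>Y\<in>carrier ?Q. Y \<oplus>\<^bsub>?Q\<^esub> X = \<zero>\<^bsub>?Q\<^esub>" by blast
  qed
  show "Module.module R ?Q"
  proof (rule Module.moduleI)
    show "cring R" by (rule R.is_cring)
    show "abelian_group ?Q" by (rule ag)
  qed (auto simp: car sm add smult_l_distr smult_r_distr smult_assoc1)
qed

lemma cring_laurent_ring: "cring (laurent_ring :: 'm::finite laurent ring)"
proof (rule cringI)
  show "abelian_group (laurent_ring :: 'm laurent ring)"
    by (rule abelian_groupI) (auto simp: laurent_ring_def algebra_simps intro: exI[of _ "- _"])
  show "comm_monoid (laurent_ring :: 'm laurent ring)"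
    by unfold_locales (auto simp: laurent_ring_def algebra_simps)
qed (auto simp: laurent_ring_def algebra_simps)

lemma free_module_support:
  fixes f :: "'b \<Rightarrow> 'm::finite laurent"
  assumes "finite {b. f b \<noteq> 0}" "finite {b. g b \<noteq> 0}" "{b. f b \<noteq> 0} \<subseteq> B" "{b. g b \<noteq> 0} \<subseteq> B"
  shows "finite {b. f b + g b \<noteq> 0}" "{b. f b + g b \<noteq> 0} \<subseteq> B"
    "finite {b. r * f b \<noteq> 0}" "{b. r * f b \<noteq> 0} \<subseteq> B"
    "finite {b. - f b \<noteq> 0}" "{b. - f b \<noteq> 0} \<subseteq> B"
proof -
  have "{b. f b + g b \<noteq> 0} \<subseteq> {b. f b \<noteq> 0} \<union> {b. g b \<noteq> 0}" "{b. r * f b \<noteq> 0} \<subseteq> {b. f b \<noteq> 0}"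
    by auto
  then show "finite {b. f b + g b \<noteq> 0}" "{b. f b + g b \<noteq> 0} \<subseteq> B"
    "finite {b. r * f b \<noteq> 0}" "{b. r * f b \<noteq> 0} \<subseteq> B" "finite {b. - f b \<noteq> 0}" "{b. - f b \<noteq> 0} \<subseteq> B"
    using assms by (auto intro: finite_subset)
qed

lemma free_module_module:
  "Module.module (laurent_ring :: 'm::finite laurent ring) (free_module B :: ('m laurent, 'b \<Rightarrow> 'm laurent) module)"
proof (rule Module.moduleI)
  let ?F = "free_module B :: ('m laurent, 'b \<Rightarrow> 'm laurent) module"
  show "abelian_group ?F"
  proof (rule abelian_groupI)
    fix x assume "x \<in> carrier ?F"
    then show "\<exists>y\<in>carrier ?F. y \<oplus>\<^bsub>?F\<^esub> x = \<zero>\<^bsub>?F\<^esub>"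
      using free_module_support(5,6)[of x x B]
      by (intro bexI[of _ "\<lambda>b. - x b"]) (auto simp: free_module_def)
  next
    fix x y assume "x \<in> carrier ?F" "y \<in> carrier ?F"
    then show "x \<oplus>\<^bsub>?F\<^esub> y \<in> carrier ?F"
      using free_module_support(1,2)[of x y B] by (simp add: free_module_def)
  qed (auto simp: free_module_def algebra_simps)
  fix r :: "'m laurent" and x assume "x \<in> carrier ?F"
  then show "r \<odot>\<^bsub>?F\<^esub> x \<in> carrier ?F"
    using free_module_support(3,4)[of x x B r] by (simp add: free_module_def)
qed (rule cring_laurent_ring, auto simp: free_module_def laurent_ring_def algebra_simps)

lemma basis_vec_carrier: "b \<in> B \<Longrightarrow> basis_vec b \<in> carrier (free_module B)"
  by (auto simp: basis_vec_def free_module_def)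

lemma crossing_relator_carrier:
  assumes "is_link (curve D)" "is_diagram_of D (curve D)" "c \<in> crossings D"
  shows "crossing_relator D c \<in> carrier (free_module (arcs D))"
proof -
  let ?S = "{over_arc D c, right_under_arc D c, left_under_arc D c}"
  have s: "{a. crossing_relator D c a \<noteq> 0} \<subseteq> ?S"
    by (auto simp: crossing_relator_def Let_def basis_vec_def)
  moreover have "?S \<subseteq> arcs D" using crossing_arcs[OF assms] by simp
  moreover have "finite {a. crossing_relator D c a \<noteq> 0}"
    by (rule finite_subset[OF s]) simp
  ultimately show ?thesis unfolding free_module_def by auto
qed

lemma rho_submodule:
  fixes D :: "'m::finite link_diagram"
  assumes D: "is_link (curve D)" "is_diagram_of D (curve D)"
  shows "submodule (rho D ` carrier (free_module (crossings D))) laurent_ring (free_module (arcs D))"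
proof -
  let ?A = "free_module (arcs D) :: ('m laurent, _) module"
  let ?C = "free_module (crossings D) :: ('m laurent, _) module"
  interpret A: Module.module laurent_ring ?A by (rule free_module_module)
  interpret C: Module.module laurent_ring ?C by (rule free_module_module)
  have fin: "finite (crossings D)" using finite_crossings[OF D] .
  have radd: "rho D (f \<oplus>\<^bsub>?C\<^esub> g) = rho D f \<oplus>\<^bsub>?A\<^esub> rho D g" for f g
    by (simp add: rho_def free_module_def algebra_simps sum.distrib)
  have rsm: "rho D (r \<odot>\<^bsub>?C\<^esub> f) = r \<odot>\<^bsub>?A\<^esub> rho D f" for r f
    by (simp add: rho_def free_module_def sum_distrib_left mult.assoc)
  have rcl: "rho D f \<in> carrier ?A" for f
  proof -
    let ?S = "\<Union>c\<in>crossings D. {a. crossing_relator D c a \<noteq> 0}"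
    have s: "{a. rho D f a \<noteq> 0} \<subseteq> ?S"
    proof
      fix a assume "a \<in> {a. rho D f a \<noteq> 0}"
      then have "\<exists>c\<in>crossings D. f c * crossing_relator D c a \<noteq> 0"
        unfolding rho_def by (metis (mono_tags, lifting) mem_Collect_eq sum.neutral)
      then show "a \<in> ?S" by force
    qed
    have "finite ?S" "?S \<subseteq> arcs D"
      using crossing_relator_carrier[OF D] fin by (auto simp: free_module_def)
    then show ?thesis using s finite_subset unfolding free_module_def by auto
  qed
  have neg: "\<ominus>\<^bsub>?A\<^esub> rho D f = rho D ((\<ominus>\<^bsub>laurent_ring\<^esub> \<one>\<^bsub>laurent_ring\<^esub>) \<odot>\<^bsub>?C\<^esub> f)" for f
    unfolding rsm using rcl[of f] A.smult_l_minus[of "\<one>\<^bsub>laurent_ring\<^esub>" "rho D f"] by simp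
  show ?thesis
  proof (rule A.submoduleI)
    show "\<zero>\<^bsub>?A\<^esub> \<in> rho D ` carrier ?C"
      by (rule image_eqI[of _ _ "\<lambda>_. 0"]) (auto simp: rho_def free_module_def)
  qed (use rcl radd[symmetric] rsm[symmetric] neg in auto)
qed

lemma alexander_module_module:
  assumes "is_link (curve D)" "is_diagram_of D (curve D)"
  shows "Module.module laurent_ring (alexander_module D)"
  unfolding alexander_module_def
  by (rule quotient_module(1)[OF free_module_module rho_submodule[OF assms]])

lemma link_module_map_exists:
  fixes D :: "'m::finite link_diagram"
  assumes D: "is_link (curve D)" "is_diagram_of D (curve D)"
  shows "\<exists>\<phi>. is_link_module_map D \<phi>"
proof -
  let ?A = "free_module (arcs D) :: ('m laurent, _) module"
  let ?C = "free_module (crossings D) :: ('m laurent, _) module"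
  let ?N = "rho D ` carrier ?C"
  let ?Q = "quotient_module ?A ?N"
  let ?I = "augmentation_ideal :: 'm laurent set"
  note mA = free_module_module[where ?B = "arcs D" and ?'m = 'm]
  interpret A: Module.module laurent_ring ?A by (rule mA)
  note sub = rho_submodule[OF D]
  interpret N: submodule ?N laurent_ring ?A by (rule sub)
  interpret N: abelian_subgroup ?N ?A
    by (rule abelian_subgroupI3[OF additive_subgroupI[OF N.subgroup_axioms] A.abelian_group_axioms])
  interpret I: ideal ?I laurent_ring
    unfolding augmentation_ideal_def by (rule A.R.genideal_ideal) (simp add: laurent_ring_def)
  have fin: "finite (crossings D)" using finite_crossings[OF D] .
  define w :: "(real^2) set \<Rightarrow> 'm laurent" where "w a = laurent_var (kappa D a) - 1" for a
  define \<psi> where "\<psi> f = (\<Sum>a\<in>{a. f a \<noteq> 0}. f a * w a)" for f :: "(real^2) set \<Rightarrow> 'm laurent"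
  have psi: "\<psi> f = (\<Sum>a\<in>S. f a * w a)" if "finite S" "{a. f a \<noteq> 0} \<subseteq> S" for f S
    unfolding \<psi>_def by (rule sum.mono_neutral_left) (use that in auto)
  have padd: "\<psi> (\<lambda>a. f a + g a) = \<psi> f + \<psi> g" if "finite {a. f a \<noteq> 0}" "finite {a. g a \<noteq> 0}" for f g
  proof -
    let ?S = "{a. f a \<noteq> 0} \<union> {a. g a \<noteq> 0}"
    have "\<psi> (\<lambda>a. f a + g a) = (\<Sum>a\<in>?S. (f a + g a) * w a)" by (rule psi) (use that in auto)
    moreover have "\<psi> f = (\<Sum>a\<in>?S. f a * w a)" "\<psi> g = (\<Sum>a\<in>?S. g a * w a)"
      by (rule psi; use that in auto)+
    ultimately show ?thesis by (simp add: sum.distrib distrib_right)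
  qed
  have psm: "\<psi> (\<lambda>a. r * f a) = r * \<psi> f" if "finite {a. f a \<noteq> 0}" for f r
  proof -
    have "\<psi> (\<lambda>a. r * f a) = (\<Sum>a\<in>{a. f a \<noteq> 0}. (r * f a) * w a)" by (rule psi) (use that in auto)
    then show ?thesis by (simp add: \<psi>_def sum_distrib_left mult.assoc)
  qed
  have pbasis: "\<psi> (basis_vec a) = w a" for a
    using psi[of "{a}" "basis_vec a"] by (auto simp: basis_vec_def)
  have prel: "\<psi> (crossing_relator D c) = 0" if c: "c \<in> crossings D" for c
  proof -
    let ?a1 = "over_arc D c" and ?a2 = "right_under_arc D c" and ?a3 = "left_under_arc D c"
    let ?S = "{?a1, ?a2, ?a3}"
    have "\<psi> (crossing_relator D c) = (\<Sum>a\<in>?S. crossing_relator D c a * w a)"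
      by (rule psi) (auto simp: crossing_relator_def Let_def basis_vec_def)
    also have "\<dots> = (\<Sum>a\<in>?S. (1 - laurent_var (kappa D ?a2)) * (basis_vec ?a1 a * w a)
        + laurent_var (kappa D ?a1) * (basis_vec ?a2 a * w a) - basis_vec ?a3 a * w a)"
      by (rule sum.cong) (auto simp: crossing_relator_def Let_def algebra_simps)
    also have "\<dots> = (1 - laurent_var (kappa D ?a2)) * (\<Sum>a\<in>?S. basis_vec ?a1 a * w a)
        + laurent_var (kappa D ?a1) * (\<Sum>a\<in>?S. basis_vec ?a2 a * w a)
        - (\<Sum>a\<in>?S. basis_vec ?a3 a * w a)"
      by (simp only: sum.distrib sum_subtractf sum_distrib_left)
    also have "(\<Sum>a\<in>?S. basis_vec ?a1 a * w a) = w ?a1"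
      using psi[of ?S "basis_vec ?a1"] pbasis by (auto simp: basis_vec_def)
    also have "(\<Sum>a\<in>?S. basis_vec ?a2 a * w a) = w ?a2"
      using psi[of ?S "basis_vec ?a2"] pbasis by (auto simp: basis_vec_def)
    also have "(\<Sum>a\<in>?S. basis_vec ?a3 a * w a) = w ?a3"
      using psi[of ?S "basis_vec ?a3"] pbasis by (auto simp: basis_vec_def)
    finally show ?thesis
      using crossing_arcs(4)[OF D c] by (simp add: w_def algebra_simps)
  qed
  have prho: "\<psi> (rho D f) = 0" for f
  proof -
    have *: "finite {a. (\<Sum>c\<in>T. f c * crossing_relator D c a) \<noteq> 0} \<and>
        \<psi> (\<lambda>a. \<Sum>c\<in>T. f c * crossing_relator D c a) = 0" if "finite T" "T \<subseteq> crossings D" for T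
      using that
    proof (induction T rule: finite_induct)
      case empty then show ?case by (simp add: \<psi>_def)
    next
      case (insert c T)
      have c: "finite {a. crossing_relator D c a \<noteq> 0}"
        using crossing_relator_carrier[OF D, of c] insert by (simp add: free_module_def)
      then have c': "finite {a. f c * crossing_relator D c a \<noteq> 0}"
        by (rule rev_finite_subset) auto
      have T: "finite {a. (\<Sum>c\<in>T. f c * crossing_relator D c a) \<noteq> 0}"
        "\<psi> (\<lambda>a. \<Sum>c\<in>T. f c * crossing_relator D c a) = 0" using insert by auto
      have "finite {a. f c * crossing_relator D c a + (\<Sum>c\<in>T. f c * crossing_relator D c a) \<noteq> 0}"
        by (rule finite_subset[OF _ finite_UnI[OF c' T(1)]]) auto
      then show ?case
        using padd[OF c' T(1)] psm[OF c] prel[of c] T(2) insert by simp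
    qed
    show ?thesis unfolding rho_def using *[OF fin] by blast
  qed
  have pI: "\<psi> f \<in> ?I" for f
  proof -
    have wI: "w a \<in> ?I" for a
      using A.R.genideal_self[of "range (\<lambda>i. laurent_var i - 1)"]
      unfolding augmentation_ideal_def w_def by (auto simp: laurent_ring_def)
    have add: "x + y \<in> ?I" if "x \<in> ?I" "y \<in> ?I" for x y
      using I.a_closed[OF that] by (simp add: laurent_ring_def)
    have mul: "x * y \<in> ?I" if "y \<in> ?I" for x y
      using I.I_l_closed[OF that, of x] by (simp add: laurent_ring_def)
    have zero: "0 \<in> ?I" using additive_subgroup.zero_closed[OF I.is_additive_subgroup] by (simp add: laurent_ring_def)
    have "(\<Sum>a\<in>S. f a * w a) \<in> ?I" if "finite S" for S
      using that by induction (auto intro: add mul wI zero)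
    then show ?thesis unfolding \<psi>_def by (cases "finite {a. f a \<noteq> 0}") (auto simp: zero)
  qed
  have fA: "finite {a. f a \<noteq> 0}" if "f \<in> carrier ?A" for f using that by (simp add: free_module_def)
  have pa: "\<psi> (x \<oplus>\<^bsub>?A\<^esub> y) = \<psi> x + \<psi> y" if "x \<in> carrier ?A" "y \<in> carrier ?A" for x y
    using padd[OF fA[OF that(1)] fA[OF that(2)]] by (simp add: free_module_def)
  define \<phi> where "\<phi> X = \<psi> (SOME f. f \<in> X)" for X
  have phi: "\<phi> (?N +>\<^bsub>?A\<^esub> f) = \<psi> f" if f: "f \<in> carrier ?A" for f
  proof -
    have "f \<in> ?N +>\<^bsub>?A\<^esub> f" using N.a_rcos_self f by simp
    then have "(SOME g. g \<in> ?N +>\<^bsub>?A\<^esub> f) \<in> ?N +>\<^bsub>?A\<^esub> f"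
      by (rule someI[of "\<lambda>g. g \<in> ?N +>\<^bsub>?A\<^esub> f"])
    then obtain n where n: "n \<in> ?N" "(SOME g. g \<in> ?N +>\<^bsub>?A\<^esub> f) = n \<oplus>\<^bsub>?A\<^esub> f"
      unfolding a_r_coset_def' by blast
    have "n \<in> carrier ?A" using n(1) N.a_Hcarr by blast
    then have "\<psi> (n \<oplus>\<^bsub>?A\<^esub> f) = \<psi> n + \<psi> f" using pa f by blast
    moreover have "\<psi> n = 0" using n(1) prho by blast
    ultimately show ?thesis unfolding \<phi>_def n(2) by simp
  qed
  have car: "carrier ?Q = {?N +>\<^bsub>?A\<^esub> x |x. x \<in> carrier ?A}"
    by (auto simp: quotient_module_def A_RCOSETS_def')
  have qadd: "(?N +>\<^bsub>?A\<^esub> x) \<oplus>\<^bsub>?Q\<^esub> (?N +>\<^bsub>?A\<^esub> y) = ?N +>\<^bsub>?A\<^esub> (x \<oplus>\<^bsub>?A\<^esub> y)"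
    if "x \<in> carrier ?A" "y \<in> carrier ?A" for x y using quotient_module(2)[OF mA sub that] .
  have qsm: "r \<odot>\<^bsub>?Q\<^esub> (?N +>\<^bsub>?A\<^esub> x) = ?N +>\<^bsub>?A\<^esub> (r \<odot>\<^bsub>?A\<^esub> x)"
    if "x \<in> carrier ?A" for r x
    using quotient_module(3)[OF mA sub _ that, of r] by (simp add: laurent_ring_def)
  have ps: "\<psi> (r \<odot>\<^bsub>?A\<^esub> x) = r * \<psi> x" if "x \<in> carrier ?A" for r x
    using psm[OF fA[OF that]] by (simp add: free_module_def)
  have lin: "\<phi> \<in> linear_maps laurent_ring ?Q augmentation_module"
    unfolding linear_maps_def
  proof (intro CollectI conjI ballI)
    show "\<phi> \<in> carrier ?Q \<rightarrow> carrier augmentation_module"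
      by (auto simp: car phi augmentation_module_def pI)
  next
    fix X Y assume "X \<in> carrier ?Q" "Y \<in> carrier ?Q"
    then obtain x y where "X = ?N +>\<^bsub>?A\<^esub> x" "Y = ?N +>\<^bsub>?A\<^esub> y" "x \<in> carrier ?A" "y \<in> carrier ?A"
      unfolding car by blast
    then show "\<phi> (X \<oplus>\<^bsub>?Q\<^esub> Y) = \<phi> X \<oplus>\<^bsub>augmentation_module\<^esub> \<phi> Y"
      by (simp add: qadd phi pa augmentation_module_def)
  next
    fix r X assume "X \<in> carrier ?Q"
    then obtain x where "X = ?N +>\<^bsub>?A\<^esub> x" "x \<in> carrier ?A" unfolding car by blast
    moreover from this have "r \<odot>\<^bsub>?A\<^esub> x \<in> carrier ?A"
      by (intro A.smult_closed) (auto simp: laurent_ring_def)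
    ultimately show "\<phi> (r \<odot>\<^bsub>?Q\<^esub> X) = r \<odot>\<^bsub>augmentation_module\<^esub> \<phi> X"
      by (simp add: qsm phi ps augmentation_module_def)
  qed
  have gen: "\<phi> (gamma D (basis_vec a)) = w a" if "a \<in> arcs D" for a
    using phi[OF basis_vec_carrier[OF that]] pbasis by (simp add: gamma_def)
  have img: "\<phi> ` carrier ?Q = \<psi> ` carrier ?A" unfolding car using phi by (auto simp: image_iff) metis
  have "ideal (\<psi> ` carrier ?A) laurent_ring"
  proof (rule idealI)
    show "ring (laurent_ring :: 'm laurent ring)" by (rule A.R.ring_axioms)
    have neg: "\<ominus>\<^bsub>laurent_ring\<^esub> x = - x" for x :: "'m laurent"
      by (rule A.R.minus_equality) (auto simp: laurent_ring_def)
    have z: "0 = \<psi> \<zero>\<^bsub>?A\<^esub>" by (simp add: free_module_def \<psi>_def)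
    have n: "- \<psi> x = \<psi> ((-1) \<odot>\<^bsub>?A\<^esub> x)" if "x \<in> carrier ?A" for x using ps[OF that, of "-1"] by simp
    have c: "r \<odot>\<^bsub>?A\<^esub> x \<in> carrier ?A" if "x \<in> carrier ?A" for r x
      using that by (intro A.smult_closed) (auto simp: laurent_ring_def)
    show "subgroup (\<psi> ` carrier ?A) (add_monoid laurent_ring)"
    proof (rule A.R.add.subgroupI)
      show "\<psi> ` carrier ?A \<subseteq> carrier laurent_ring" by (simp add: laurent_ring_def)
      show "\<psi> ` carrier ?A \<noteq> {}" using A.zero_closed by blast
    next
      fix a assume "a \<in> \<psi> ` carrier ?A"
      then show "\<ominus>\<^bsub>laurent_ring\<^esub> a \<in> \<psi> ` carrier ?A" using n c neg by auto
    next
      fix a b assume "a \<in> \<psi> ` carrier ?A" "b \<in> \<psi> ` carrier ?A"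
      then obtain x y where "a = \<psi> x" "b = \<psi> y" "x \<in> carrier ?A" "y \<in> carrier ?A" by blast
      then have "a + b = \<psi> (x \<oplus>\<^bsub>?A\<^esub> y)" "x \<oplus>\<^bsub>?A\<^esub> y \<in> carrier ?A" using pa by auto
      then show "a \<oplus>\<^bsub>laurent_ring\<^esub> b \<in> \<psi> ` carrier ?A" by (simp add: laurent_ring_def)
    qed
    fix a r assume "a \<in> \<psi> ` carrier ?A"
    then obtain x where x: "a = \<psi> x" "x \<in> carrier ?A" by blast
    then have "r * a = \<psi> (r \<odot>\<^bsub>?A\<^esub> x)" using ps by simp
    then show "r \<otimes>\<^bsub>laurent_ring\<^esub> a \<in> \<psi> ` carrier ?A" "a \<otimes>\<^bsub>laurent_ring\<^esub> r \<in> \<psi> ` carrier ?A"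
      using c[OF x(2), of r] by (auto simp: laurent_ring_def mult.commute)
  qed
  moreover have "range (\<lambda>i. laurent_var i - 1) \<subseteq> \<psi> ` carrier ?A"
  proof
    fix v :: "'m laurent" assume "v \<in> range (\<lambda>i. laurent_var i - 1)"
    then obtain i where i: "v = laurent_var i - 1" by blast
    obtain a where "a \<in> arcs D" "kappa D a = i" using ex_arc_of_component[OF D] by blast
    then show "v \<in> \<psi> ` carrier ?A"
      using pbasis[of a] basis_vec_carrier[of a "arcs D"] i by (auto simp: w_def image_iff intro!: bexI)
  qed
  ultimately have "?I \<subseteq> \<psi> ` carrier ?A"
    unfolding augmentation_ideal_def by (rule A.R.genideal_minimal)
  then have "\<phi> ` carrier ?Q = ?I" using img pI by auto
  then have "is_link_module_map D \<phi>"
    using lin gen by (simp add: is_link_module_map_def alexander_module_def w_def)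
  then show ?thesis by blast
qed

end

theory Submission
  imports Defs
begin

text \<open>
  The key point is that \<open>\<phi> (x \<triangleright> y) = (\<phi> y + 1) \<phi> x - \<phi> x \<phi> y = \<phi> x\<close>.  Hence, with
  \<open>a, b, c\<close> the values of \<open>\<phi>\<close> at \<open>x, y, z\<close>, both sides of (Q3) are equal to
  \<open>(b + 1)(c + 1) x - a (c + 1) y - a z\<close>.
\<close>

context Module.module
begin

lemma smult_diff_right:
  assumes "r \<in> carrier R" "x \<in> carrier M" "y \<in> carrier M"
  shows "r \<odot>\<^bsub>M\<^esub> (x \<ominus>\<^bsub>M\<^esub> y) = r \<odot>\<^bsub>M\<^esub> x \<ominus>\<^bsub>M\<^esub> r \<odot>\<^bsub>M\<^esub> y"
  using assms by (simp add: a_minus_def smult_r_distr smult_r_minus)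

end

text \<open>The target is \<open>R\<close> itself rather than an ideal of it, so that a value of
  \<open>\<phi>\<close> can serve directly as a scalar. The quandle identities are then pure module
  algebra over a commutative ring, free of links and diagrams.\<close>

locale linear_form = Module.module R M
  for R :: "('r, 's) ring_scheme" (structure) and M :: "('r, 'x) module" +
  fixes \<phi> :: "'x \<Rightarrow> 'r"
  assumes closed: "\<phi> \<in> carrier M \<rightarrow> carrier R"
    and add: "x \<in> carrier M \<Longrightarrow> y \<in> carrier M \<Longrightarrow> \<phi> (x \<oplus>\<^bsub>M\<^esub> y) = \<phi> x \<oplus> \<phi> y"
    and smult: "r \<in> carrier R \<Longrightarrow> x \<in> carrier M \<Longrightarrow> \<phi> (r \<odot>\<^bsub>M\<^esub> x) = r \<otimes> \<phi> x"
begin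

lemma quandle_op_closed:
  assumes "x \<in> carrier M" "y \<in> carrier M"
  shows "quandle_op R M \<phi> x y \<in> carrier M"
proof -
  have "\<phi> x \<in> carrier R" "\<phi> y \<in> carrier R" using assms closed by auto
  then show ?thesis using assms by (simp add: quandle_op_def)
qed

lemma quandle_op_idem:
  assumes "x \<in> carrier M"
  shows "quandle_op R M \<phi> x x = x"
proof -
  have "\<phi> x \<in> carrier R" using assms closed by auto
  then show ?thesis
    using assms by (simp add: quandle_op_def smult_l_distr M.minus_eq M.a_ac M.r_neg)
qed

lemma form_quandle_op:
  assumes x: "x \<in> carrier M" and y: "y \<in> carrier M"
  shows "\<phi> (quandle_op R M \<phi> x y) = \<phi> x"
proof -
  have [simp]: "\<phi> x \<in> carrier R" "\<phi> y \<in> carrier R" using closed x y by auto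
  \<comment> \<open>The difference becomes a sum by moving the sign into the scalar, because the
    locale gives \<open>add\<close> and \<open>smult\<close> but no rule for differences.\<close>
  have "quandle_op R M \<phi> x y = (\<phi> y \<oplus> \<one>) \<odot>\<^bsub>M\<^esub> x \<oplus>\<^bsub>M\<^esub> (\<ominus> \<phi> x) \<odot>\<^bsub>M\<^esub> y"
    using x y by (simp add: quandle_op_def M.minus_eq smult_l_minus)
  then have "\<phi> (quandle_op R M \<phi> x y) = (\<phi> y \<oplus> \<one>) \<otimes> \<phi> x \<oplus> (\<ominus> \<phi> x) \<otimes> \<phi> y"
    using x y by (simp add: add smult)
  also have "\<dots> = \<phi> x"
    by (simp add: R.l_distr R.l_minus R.m_comm[of "\<phi> y"] R.a_ac R.r_neg)
  finally show ?thesis .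
qed

lemma quandle_op_distrib:
  assumes x: "x \<in> carrier M" and y: "y \<in> carrier M" and z: "z \<in> carrier M"
  shows "quandle_op R M \<phi> (quandle_op R M \<phi> x y) z =
         quandle_op R M \<phi> (quandle_op R M \<phi> x z) (quandle_op R M \<phi> y z)"
proof -
  define a b c where "a = \<phi> x" and "b = \<phi> y" and "c = \<phi> z"
  have [simp]: "a \<in> carrier R" "b \<in> carrier R" "c \<in> carrier R"
    using closed x y z by (auto simp: a_def b_def c_def)
  note [simp] = x y z
  \<comment> \<open>\<open>u\<close> and \<open>v\<close> come from expanding the left side.
    \<open>w\<close> arises only on the right, once from each inner operation, and cancels
    there.\<close>
  define u v w where "u = ((b \<oplus> \<one>) \<otimes> (c \<oplus> \<one>)) \<odot>\<^bsub>M\<^esub> x"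
    and "v = (a \<otimes> (c \<oplus> \<one>)) \<odot>\<^bsub>M\<^esub> y" and "w = (a \<otimes> b) \<odot>\<^bsub>M\<^esub> z"
  have [simp]: "u \<in> carrier M" "v \<in> carrier M" "w \<in> carrier M"
    by (simp_all add: u_def v_def w_def)
  \<comment> \<open>The instantiated definition unfolds the outer operation alone, so
    \<open>form_quandle_op\<close> can evaluate \<open>\<phi>\<close> at the inner one while it is
    still folded; the second call unfolds the inner one.\<close>
  have "quandle_op R M \<phi> (quandle_op R M \<phi> x y) z =
      (c \<oplus> \<one>) \<odot>\<^bsub>M\<^esub> ((b \<oplus> \<one>) \<odot>\<^bsub>M\<^esub> x \<ominus>\<^bsub>M\<^esub> a \<odot>\<^bsub>M\<^esub> y) \<ominus>\<^bsub>M\<^esub> a \<odot>\<^bsub>M\<^esub> z"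
    by (simp add: quandle_op_def[of R M \<phi> "quandle_op R M \<phi> x y"] form_quandle_op
        quandle_op_closed)
       (simp add: quandle_op_def a_def b_def c_def)
  also have "\<dots> = (u \<ominus>\<^bsub>M\<^esub> v) \<ominus>\<^bsub>M\<^esub> a \<odot>\<^bsub>M\<^esub> z"
    by (simp add: smult_diff_right u_def v_def smult_assoc1[symmetric] R.m_comm)
  also have "\<dots> = (u \<ominus>\<^bsub>M\<^esub> (w \<oplus>\<^bsub>M\<^esub> a \<odot>\<^bsub>M\<^esub> z)) \<ominus>\<^bsub>M\<^esub> (v \<ominus>\<^bsub>M\<^esub> w)"
  proof -
    \<comment> \<open>Sorting the summands leaves the negative of \<open>v\<close> between
      \<open>w\<close> and its negative, so their cancellation is stated in that shape, with
      \<open>p\<close> for the remaining terms.\<close>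
    have cancel: "w \<oplus>\<^bsub>M\<^esub> (\<ominus>\<^bsub>M\<^esub> v \<oplus>\<^bsub>M\<^esub> (\<ominus>\<^bsub>M\<^esub> w \<oplus>\<^bsub>M\<^esub> p)) = \<ominus>\<^bsub>M\<^esub> v \<oplus>\<^bsub>M\<^esub> p"
      if "p \<in> carrier M" for p
      using that by (simp add: M.a_lcomm[of w "\<ominus>\<^bsub>M\<^esub> v"] M.r_neg2)
    show ?thesis
      by (simp add: cancel M.minus_eq M.minus_add M.a_ac)
  qed
  also have "\<dots> = (b \<oplus> \<one>) \<odot>\<^bsub>M\<^esub> ((c \<oplus> \<one>) \<odot>\<^bsub>M\<^esub> x \<ominus>\<^bsub>M\<^esub> a \<odot>\<^bsub>M\<^esub> z) \<ominus>\<^bsub>M\<^esub>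
      a \<odot>\<^bsub>M\<^esub> ((c \<oplus> \<one>) \<odot>\<^bsub>M\<^esub> y \<ominus>\<^bsub>M\<^esub> b \<odot>\<^bsub>M\<^esub> z)"
  proof -
    \<comment> \<open>One copy of \<open>w\<close> is the \<open>b\<close> part of the scalar
      \<open>b + 1\<close> acting on \<open>a z\<close>; the other is \<open>a\<close> times
      \<open>b z\<close>.\<close>
    have "(b \<oplus> \<one>) \<odot>\<^bsub>M\<^esub> (a \<odot>\<^bsub>M\<^esub> z) = w \<oplus>\<^bsub>M\<^esub> a \<odot>\<^bsub>M\<^esub> z"
      by (simp add: w_def smult_l_distr smult_assoc1 R.m_comm[of a b])
    then show ?thesis
      by (simp add: smult_diff_right u_def v_def w_def smult_assoc1)
  qed
  also have "\<dots> = quandle_op R M \<phi> (quandle_op R M \<phi> x z) (quandle_op R M \<phi> y z)"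
    by (simp add: quandle_op_def[of R M \<phi> "quandle_op R M \<phi> x z"] form_quandle_op
        quandle_op_closed)
       (simp add: quandle_op_def a_def b_def c_def)
  finally show ?thesis .
qed

end

theorem proposition7:
  fixes L :: "'m::finite \<Rightarrow> real \<Rightarrow> real^4"
    and D :: "'m link_diagram"
    and \<phi> :: "((real^2) set \<Rightarrow> 'm laurent) set \<Rightarrow> 'm laurent"
  defines "M \<equiv> alexander_module D"
  defines "op \<equiv> quandle_op laurent_ring M \<phi>"
  assumes "is_link L"
    and "is_diagram_of D L"
    and "is_link_module_map D \<phi>"
  shows "(\<forall>x\<in>carrier M. op x x = x) \<and>
         (\<forall>x\<in>carrier M. \<forall>y\<in>carrier M. \<forall>z\<in>carrier M.
            op (op x y) z = op (op x z) (op y z))"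
proof -
  have D: "is_link (curve D)" "is_diagram_of D (curve D)"
    using assms(3,4) by (auto simp: is_diagram_of_def)
  interpret Module.module laurent_ring M
    unfolding M_def by (rule alexander_module_module[OF D])
  have lin: "\<phi> \<in> linear_maps laurent_ring M augmentation_module"
    using assms(5) by (simp add: is_link_module_map_def M_def)
  \<comment> \<open>Sum and scalar action of \<open>augmentation_module\<close> are those of
    \<open>laurent_ring\<close>, whose carrier is \<open>UNIV\<close>, so a linear map into the
    ideal is a linear form.\<close>
  interpret linear_form laurent_ring M \<phi>
    using lin by unfold_locales
      (auto simp: linear_maps_def laurent_ring_def augmentation_module_def)
  show ?thesis
    unfolding op_def
    using quandle_op_idem quandle_op_distrib by blast
qed

end
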